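(* Let $X$ be a normed space, let $x=\{x_t\}_{t\in\mathbb{N}}$ be a sequence in $X$, let $\mathcal{I}$ be an ideal on $\mathbb{N}$, and let $\{\omega_t\}_{t\in\mathbb{N}}$ be an $\mathcal{I}$-bounded weighted sequence. If $r$ is a real number with $r>\tilde r(x)$, then the interior of $(\omega_t,\mathcal{I})\text{-}\mathrm{LIM}^r x_t$ in $X$ is non-empty.
   Context: A sequence $\{\omega_t\}_{t\in\mathbb{N}}$ of real numbers is a weighted sequence if there is $\beta>0$ with $\omega_t>\beta$ for all $t\in\mathbb{N}$. An ideal on $\mathbb{N}$ is a family $\mathcal{I}\subseteq\mathcal{P}(\mathbb{N})$ with $\varnothing\in\mathcal{I}$, closed under finite unions and under taking subsets. A weighted sequence $\{\omega_t\}$ is $\mathcal{I}$-bounded if there is $\mu>0$ with $\{t\in\mathbb{N}:\omega_t>\mu\}\in\mathcal{I}$. For $r\ge0$, $(\omega_t,\mathcal{I})\text{-}\mathrm{LIM}^r x_t$ is the set of all $x_*\in X$ such that $\{t\in\mathbb{N}:\omega_t\|x_t-x_*\|>r+\varepsilon\}\in\mathcal{I}$ for every $\varepsilon>0$. The minimal weighted ideal convergent degree of $x$ is $\tilde r(x)=\tilde r_{(\omega_t,\mathcal{I})}(x):=\inf\{r\in(0,\infty):(\omega_t,\mathcal{I})\text{-}\mathrm{LIM}^r x_t\ne\varnothing\}$ (with $\inf\varnothing=\infty$). *)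

theory Defs
  imports "HOL-Analysis.Analysis"
begin

definition ideal_on_nat :: "nat set set \<Rightarrow> bool" where
  "ideal_on_nat \<I> \<longleftrightarrow>
     {} \<in> \<I> \<and>
     (\<forall>A\<in>\<I>. \<forall>B\<in>\<I>. A \<union> B \<in> \<I>) \<and>
     (\<forall>A\<in>\<I>. \<forall>B. B \<subseteq> A \<longrightarrow> B \<in> \<I>)"

definition weighted_seq :: "(nat \<Rightarrow> real) \<Rightarrow> bool" where
  "weighted_seq \<omega> \<longleftrightarrow> (\<exists>\<beta>>0. \<forall>t. \<omega> t > \<beta>)"

definition ideal_bounded :: "nat set set \<Rightarrow> (nat \<Rightarrow> real) \<Rightarrow> bool" where
  "ideal_bounded \<I> \<omega> \<longleftrightarrow> (\<exists>\<mu>>0. {t. \<omega> t > \<mu>} \<in> \<I>)"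

text \<open>The rough limit set is meant for \<open>r \<ge> 0\<close>; for other \<open>r\<close> the formula is merely total.\<close>

definition weighted_ideal_LIM ::
  "(nat \<Rightarrow> real) \<Rightarrow> nat set set \<Rightarrow> real \<Rightarrow> (nat \<Rightarrow> 'a::real_normed_vector) \<Rightarrow> 'a set" where
  "weighted_ideal_LIM \<omega> \<I> r x =
     {x0. \<forall>\<epsilon>>0. {t. \<omega> t * norm (x t - x0) > r + \<epsilon>} \<in> \<I>}"

text \<open>The infimum is taken in the extended reals, where the infimum of the empty set
  is \<open>\<infinity>\<close>; in \<open>real\<close> that infimum would be an unspecified finite number.\<close>

definition min_weighted_ideal_degree ::
  "(nat \<Rightarrow> real) \<Rightarrow> nat set set \<Rightarrow> (nat \<Rightarrow> 'a::real_normed_vector) \<Rightarrow> ereal" where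
  "min_weighted_ideal_degree \<omega> \<I> x =
     Inf (ereal ` {r. 0 < r \<and> weighted_ideal_LIM \<omega> \<I> r x \<noteq> {}})"

end

theory Submission
  imports Defs
begin

text \<open>
  Rough limits survive small perturbations at the price of a larger degree. Outside a set in the
  ideal the weights are at most some \<open>\<mu>\<close>, so moving a rough limit point by a distance \<open>d\<close> increases
  the weighted distances \<open>\<omega> t * norm (x t - x0)\<close> by at most \<open>\<mu> * d\<close>. As \<open>r\<close> exceeds
  the minimal degree, some smaller degree \<open>s\<close> already admits a rough limit point \<open>x0\<close>, and the slack
  \<open>r - s\<close> pays for every move of length below \<open>(r - s) / \<mu>\<close>: an entire ball around \<open>x0\<close> consists of
  rough limit points of degree \<open>r\<close>.
\<close>

lemma ball_subset_weighted_ideal_LIM: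
  fixes x :: "nat \<Rightarrow> 'a::real_normed_vector"
  assumes ideal: "ideal_on_nat \<I>"
    and nonneg: "\<And>t. 0 \<le> \<omega> t"
    and "0 < \<mu>" and large: "{t. \<omega> t > \<mu>} \<in> \<I>"
    and x0: "x0 \<in> weighted_ideal_LIM \<omega> \<I> s x"
  shows "ball x0 ((r - s) / \<mu>) \<subseteq> weighted_ideal_LIM \<omega> \<I> r x"
proof
  fix y assume "y \<in> ball x0 ((r - s) / \<mu>)"
  then have near: "\<mu> * norm (x0 - y) < r - s"
    using \<open>0 < \<mu>\<close> by (simp add: dist_norm field_simps)
  have "{t. \<omega> t * norm (x t - y) > r + \<epsilon>} \<in> \<I>" if "\<epsilon> > 0" for \<epsilon>
  proof -
    let ?A = "{t. \<omega> t > \<mu>} \<union> {t. \<omega> t * norm (x t - x0) > s + \<epsilon>}"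
    have "?A \<in> \<I>"
      using ideal large x0 that unfolding ideal_on_nat_def weighted_ideal_LIM_def by blast
    moreover have "{t. \<omega> t * norm (x t - y) > r + \<epsilon>} \<subseteq> ?A"
    proof (rule subsetI, rule ccontr)
      fix t assume t: "t \<in> {t. \<omega> t * norm (x t - y) > r + \<epsilon>}" and "t \<notin> ?A"
      then have small: "\<omega> t \<le> \<mu>" "\<omega> t * norm (x t - x0) \<le> s + \<epsilon>" by auto
      have "norm (x t - y) \<le> norm (x t - x0) + norm (x0 - y)"
        using norm_triangle_ineq[of "x t - x0" "x0 - y"] by simp
      then have "\<omega> t * norm (x t - y) \<le> \<omega> t * norm (x t - x0) + \<omega> t * norm (x0 - y)"
        using mult_left_mono[OF _ nonneg] by (simp flip: distrib_left)
      also have "\<dots> \<le> (s + \<epsilon>) + \<mu> * norm (x0 - y)"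
        using small by (intro add_mono mult_right_mono) auto
      finally show False using near t by simp
    qed
    ultimately show ?thesis using ideal unfolding ideal_on_nat_def by blast
  qed
  then show "y \<in> weighted_ideal_LIM \<omega> \<I> r x" by (simp add: weighted_ideal_LIM_def)
qed

theorem proposition3p2:
  fixes x :: "nat \<Rightarrow> 'a::real_normed_vector"
    and \<I> :: "nat set set"
    and \<omega> :: "nat \<Rightarrow> real"
    and r :: real
  assumes "ideal_on_nat \<I>"
    and "weighted_seq \<omega>"
    and "ideal_bounded \<I> \<omega>"
    and "ereal r > min_weighted_ideal_degree \<omega> \<I> x"
  shows "interior (weighted_ideal_LIM \<omega> \<I> r x) \<noteq> {}"
proof -
  obtain s x0 where "s < r" and x0: "x0 \<in> weighted_ideal_LIM \<omega> \<I> s x"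
    using assms(4) unfolding min_weighted_ideal_degree_def Inf_less_iff by auto
  obtain \<mu> where \<mu>: "0 < \<mu>" "{t. \<omega> t > \<mu>} \<in> \<I>"
    using assms(3) unfolding ideal_bounded_def by blast
  have "0 \<le> \<omega> t" for t
    using assms(2) unfolding weighted_seq_def by (meson less_trans less_imp_le)
  then have "ball x0 ((r - s) / \<mu>) \<subseteq> weighted_ideal_LIM \<omega> \<I> r x"
    using ball_subset_weighted_ideal_LIM assms(1) \<mu> x0 by blast
  moreover have "x0 \<in> ball x0 ((r - s) / \<mu>)" using \<open>s < r\<close> \<mu>(1) by simp
  ultimately show ?thesis using interior_maximal[OF _ open_ball] by blast
qed

end
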